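(* Let $D=\{f(a,a): a\ge 0\}$ and $S=\{p\ge 1: f(p,r)=p \text{ for some integer } r \text{ with } 0\le r<p\}$. Let $n$ be a positive integer and consider the (unique) winning opening move from the three-row Chomp rectangle $[n,n,n]$. Then: (1) No winning opening move from $[n,n,n]$ is made in the first row. (2) The winning opening move is made in the second row if and only if $n\in D$; in that case it is the move to $[n,a,a]$, where $a<n$ is the uniquely determined integer with $n=f(a,a)$. (3) The winning opening move is made in the third row if and only if $n\in S$; in that case it is the move to $[n,n,r]$, where $r<n$ is the uniquely determined integer with $f(n,r)=n$. Equivalently, the second-row values of $n$ form the OEIS sequence A029900 and the third-row values of $n$ form the OEIS sequence A029901. The first terms, in increasing order, of the two sequences of board sizes $n$ are: second row: $1,3,4,6,8,10,11,13,15,16,18,20,21,24,25,27,\ldots$; third row: $2,5,7,9,12,14,17,19,22,23,26,29,31,33,36,38,\ldots$.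
   Context: Three-row Chomp. A position is a triple $[p,q,r]$ of integers with $p\ge q\ge r\ge 0$, giving the lengths of the first, second and third rows of a left-justified board. Two players alternate moves. The moves from $[p,q,r]$ are: reduce the first row to length $a$ with $0\le a<p$ (a move made in the first row), giving $[a,\min(a,q),\min(a,r)]$; reduce the second row to length $a$ with $0\le a<q$ (a move made in the second row), giving $[p,a,\min(a,r)]$; reduce the third row to length $b$ with $0\le b<r$ (a move made in the third row), giving $[p,q,b]$. The player who moves to $[0,0,0]$ loses. A $P$-position is a position from which the previous player wins, and an $N$-position is one from which the next player wins. Equivalently: $[0,0,0]$ is an $N$-position, and a position other than $[0,0,0]$ is a $P$-position if and only if no move from it leads to a $P$-position. A move is winning if it leads to a $P$-position. The function $f$. For all integers $q\ge r\ge 0$ there is a unique integer $p>r$ such that either (i) $r<p<q$ and $[p,p,r]$ is a $P$-position, or (ii) $p\ge q$ and $[p,q,r]$ is a $P$-position. This integer is denoted $f(q,r)$. OEIS sequences. A029900 and A029901 denote the two three-row Chomp opening-move sequences: the board sizes $n$ for which $[n,n,n]$ has a winning opening move in the second row, respectively in the third row. *)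

theory Defs
  imports Main
begin

text \<open>Row lengths \<open>(p, q, r)\<close> of a board. Only triples with \<open>p \<ge> q \<ge> r\<close> are positions; moves
  preserve this (lemma \<open>move_preserves_board\<close>), so the values of the predicates below on other
  triples never matter.\<close>
type_synonym position = "nat \<times> nat \<times> nat"

datatype row = First | Second | Third

inductive move :: "row \<Rightarrow> position \<Rightarrow> position \<Rightarrow> bool" where
  "a < p \<Longrightarrow> move First (p, q, r) (a, min a q, min a r)"
| "a < q \<Longrightarrow> move Second (p, q, r) (p, a, min a r)"
| "b < r \<Longrightarrow> move Third (p, q, r) (p, q, b)"

lemma move_preserves_board:
  assumes "move i (p, q, r) (p', q', r')" and "q \<le> p" and "r \<le> q"
  shows "q' \<le> p' \<and> r' \<le> q'"
  using assms by (auto elim!: move.cases)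

text \<open>The player to move wins at \<open>(0, 0, 0)\<close>, because moving there loses.\<close>
inductive N_position :: "position \<Rightarrow> bool" and P_position :: "position \<Rightarrow> bool" where
  N_end: "N_position (0, 0, 0)"
| N_step: "move i x y \<Longrightarrow> P_position y \<Longrightarrow> N_position x"
| P_step: "x \<noteq> (0, 0, 0) \<Longrightarrow> (\<forall>i y. move i x y \<longrightarrow> N_position y) \<Longrightarrow> P_position x"

lemma move_decreases:
  assumes "move i x y"
  shows "(case y of (p, q, r) \<Rightarrow> p + q + r) < (case x of (p, q, r) \<Rightarrow> p + q + r)"
  using assms by (cases) auto

lemma N_position_iff: "N_position x \<longleftrightarrow> \<not> P_position x"
proof (induction x rule: measure_induct_rule[where f = "\<lambda>(p, q, r). p + q + r"])
  case (less x)
  have IH: "N_position y \<longleftrightarrow> \<not> P_position y" if "move i x y" for i y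
    using less move_decreases[OF that] by blast
  have no_move: "\<not> move i (0, 0, 0) y" for i y
    using move_decreases[of i "(0, 0, 0)" y] by auto
  have N: "N_position x \<longleftrightarrow> x = (0, 0, 0) \<or> (\<exists>i y. move i x y \<and> P_position y)"
    by (subst N_position.simps) blast
  have P: "P_position x \<longleftrightarrow> x \<noteq> (0, 0, 0) \<and> (\<forall>i y. move i x y \<longrightarrow> N_position y)"
    by (subst P_position.simps) blast
  show ?case
    using IH no_move N P by blast
qed

lemma P_position_iff:
  "P_position x \<longleftrightarrow> x \<noteq> (0, 0, 0) \<and> (\<forall>i y. move i x y \<longrightarrow> \<not> P_position y)"
  using P_position.simps[of x] by (auto simp: N_position_iff)

definition winning_move :: "row \<Rightarrow> position \<Rightarrow> position \<Rightarrow> bool" where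
  "winning_move i x y \<longleftrightarrow> move i x y \<and> P_position y"

text \<open>Meaningful for \<open>r \<le> q\<close>.\<close>
definition f :: "nat \<Rightarrow> nat \<Rightarrow> nat" where
  "f q r = (THE p. (r < p \<and> p < q \<and> P_position (p, p, r)) \<or>
                   (r < p \<and> q \<le> p \<and> P_position (p, q, r)))"

definition D :: "nat set" where
  "D = {f a a |a. True}"

definition S :: "nat set" where
  "S = {p. p \<ge> 1 \<and> (\<exists>r<p. f p r = p)}"

definition A029900 :: "nat set" where
  "A029900 = {n. n \<ge> 1 \<and> (\<exists>y. winning_move Second (n, n, n) y)}"

definition A029901 :: "nat set" where
  "A029901 = {n. n \<ge> 1 \<and> (\<exists>y. winning_move Third (n, n, n) y)}"

end

theory Submission
  imports Defs "HOL-Library.Code_Binary_Nat"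
begin

text \<open>By strategy stealing \<open>(n, n, n)\<close> is never a P-position, so for every \<open>n \<ge> 1\<close> some \<open>(n, a, a)\<close> or some
  \<open>(n, n, r)\<close> with smaller \<open>a\<close>, \<open>r\<close> is one. That both cannot happen is a pigeonhole argument when \<open>r < a\<close>: take the
  largest \<open>y < n\<close> for which no \<open>(n, y, c)\<close> with \<open>c < r\<close> is a P-position (\<open>a\<close> is such a value). Every \<open>x\<close>
  strictly between \<open>y\<close> and \<open>n\<close> has a P-position \<open>(n, x, c)\<close> with \<open>c < r\<close>. For these \<open>n - y - 1\<close> distinct
  values \<open>c\<close>, and for \<open>r\<close> itself, the position \<open>(n, y, c)\<close> can only be won by moving to some P-position
  \<open>(m, y, c)\<close> with \<open>y < m < n\<close>; but the values \<open>m\<close> must be distinct, and there are only \<open>n - y - 1\<close> of them.\<close>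

section \<open>Single moves between P-positions, and strategy stealing\<close>

lemma P_no_move: "P_position x \<Longrightarrow> move i x y \<Longrightarrow> \<not> P_position y"
  using P_position_iff by blast

lemma P_no_First: "P_position (p, q, r) \<Longrightarrow> a < p \<Longrightarrow> \<not> P_position (a, min a q, min a r)"
  using P_no_move move.intros(1) by blast

lemma P_no_Second: "P_position (p, q, r) \<Longrightarrow> a < q \<Longrightarrow> \<not> P_position (p, a, min a r)"
  using P_no_move move.intros(2) by blast

lemma P_no_Third: "P_position (p, q, r) \<Longrightarrow> b < r \<Longrightarrow> \<not> P_position (p, q, b)"
  using P_no_move move.intros(3) by blast

lemma not_P_cases [consumes 2, case_names First Second Third]:
  assumes "\<not> P_position (p, q, r)" and "(p, q, r) \<noteq> (0, 0, 0)"
  obtains a where "a < p" "P_position (a, min a q, min a r)"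
  | a where "a < q" "P_position (p, a, min a r)"
  | b where "b < r" "P_position (p, q, b)"
proof -
  obtain i y where "move i (p, q, r) y" "P_position y"
    using assms P_position_iff by blast
  then show thesis
    using that by (auto elim: move.cases)
qed

text \<open>Strategy stealing: every reply to \<open>(n, n, n - 1)\<close> is also a move from \<open>(n, n, n)\<close>.\<close>
lemma cube_not_P: "\<not> P_position (n, n, n)"
proof
  assume P: "P_position (n, n, n)"
  then have "n > 0"
    by (metis P_position_iff gr0I)
  then have "\<not> P_position (n, n, n - 1)" "(n, n, n - 1) \<noteq> (0, 0, 0)"
    using P P_no_Third by simp_all
  then show False
  proof (cases rule: not_P_cases)
    case (First a)
    then show False
      using P_no_First[OF P, of a] by (simp add: min_def split: if_splits)
  next
    case (Second a)
    then show False
      using P_no_Second[OF P, of a] by (simp add: min_def split: if_splits)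
  next
    case (Third b)
    then show False
      using P_no_Third[OF P, of b] by simp
  qed
qed

section \<open>Well-definedness of \<open>f\<close> and its link to P-positions\<close>

text \<open>Shortening the first row of the larger candidate to the smaller length leaves the third
  row intact, as both lengths exceed \<open>r\<close>, and so joins two P-positions by a
  move.\<close>

lemma f_candidate_unique:
  assumes "r < p" "P_position (p, min p q, r)" "r < p'" "P_position (p', min p' q, r)"
  shows "p = p'"
proof -
  have *: "\<not> P_position (a, min a q, r)" if "P_position (b, min b q, r)" "r < a" "a < b" for a b
    using P_no_First[OF that(1,3)] that(2,3) by (simp add: min_def split: if_splits)
  show ?thesis
    using assms * by (metis linorder_neqE_nat)
qed

text \<open>If no candidate existed, each \<open>(p, q, r)\<close> with \<open>p > q\<close> would have a winning move in the second or
  third row, and the resulting lower rows would determine \<open>p\<close>.\<close>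
lemma f_candidate_exists:
  assumes "r \<le> q"
  shows "\<exists>p. r < p \<and> P_position (p, min p q, r)"
proof (rule ccontr)
  assume none: "\<not> ?thesis"
  have "\<exists>bc. bc \<in> {..q} \<times> {..r} \<and> P_position (p, bc)" if "p > q" for p
  proof -
    have "min p q = q" "r < p"
      using that assms by auto
    then have "\<not> P_position (p, q, r)" "(p, q, r) \<noteq> (0, 0, 0)"
      using none by auto
    then show ?thesis
    proof (cases rule: not_P_cases)
      case (First a)
      \<comment> \<open>Otherwise the third row would still be \<open>r\<close>, and
        \<open>a\<close> would be the candidate excluded by \<open>none\<close>.\<close>
      then have "a \<le> r"
        using none by (metis min.absorb2 not_le_imp_less less_imp_le)
      then have "P_position (a, a, a)"
        using First assms by (simp add: min_def split: if_splits)
      then show ?thesis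
        using cube_not_P by blast
    next
      case (Second a)
      then show ?thesis
        by (intro exI[of _ "(a, min a r)"]) simp
    next
      case (Third b)
      then show ?thesis
        by (intro exI[of _ "(q, b)"]) simp
    qed
  qed
  then obtain g where g: "\<And>p. p > q \<Longrightarrow> g p \<in> {..q} \<times> {..r} \<and> P_position (p, g p)"
    by metis
  have ne: "g a \<noteq> g b" if "q < a" "a < b" for a b
  proof
    assume eq: "g a = g b"
    obtain x y where xy: "g a = (x, y)" "x \<le> q" "y \<le> q"
      using g[of a] \<open>q < a\<close> assms by fastforce
    have "P_position (b, x, y)" "P_position (a, x, y)"
      using g[of a] g[of b] eq xy that by auto
    then show False
      using P_no_First[of b x y a] xy that by (simp add: min_def split: if_splits)
  qed
  have "inj_on g {q<..}"
    using ne by (intro inj_onI) (metis greaterThan_iff linorder_neqE_nat)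
  moreover have "g ` {q<..} \<subseteq> {..q} \<times> {..r}"
    using g by blast
  ultimately have "finite {q<..}"
    by (meson finite_SigmaI finite_atMost finite_imageD finite_subset)
  then show False
    using infinite_Ioi by blast
qed

text \<open>Writing the second row as \<open>min p q\<close> merges the two alternatives in the
  definition of \<open>f\<close>.\<close>

lemma f_eq_iff:
  assumes "r \<le> q"
  shows "f q r = p \<longleftrightarrow> r < p \<and> P_position (p, min p q, r)"
proof -
  have "f q r = (THE p. r < p \<and> P_position (p, min p q, r))"
    unfolding f_def by (rule arg_cong[where f = The]) (auto simp: fun_eq_iff min_def order_le_less)
  moreover obtain p' where p': "r < p'" "P_position (p', min p' q, r)"
    using f_candidate_exists[OF assms] by blast
  ultimately have "f q r = p'"
    using f_candidate_unique by (metis (no_types, lifting) the_equality)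
  then show ?thesis
    using p' f_candidate_unique by blast
qed

lemma less_f: "r \<le> q \<Longrightarrow> r < f q r"
  using f_eq_iff[of r q "f q r"] by simp

text \<open>Only \<open>r < p\<close> has to be supplied: its failure would force
  \<open>p = q = r\<close>, a cube.\<close>

lemma P_iff_f:
  assumes "r \<le> q" "q \<le> p"
  shows "P_position (p, q, r) \<longleftrightarrow> f q r = p"
proof -
  have "P_position (p, q, r) \<Longrightarrow> r < p"
    using assms cube_not_P[of p] by (metis le_antisym le_trans not_le_imp_less)
  then show ?thesis
    using f_eq_iff[OF assms(1)] assms(2) by (auto simp: min_def)
qed

section \<open>No P-positions of both kinds for one \<open>n\<close>\<close>

text \<open>If \<open>(n, x, c)\<close> is a P-position and \<open>y < x\<close>, the only moves from \<open>(n, y, c)\<close> that are not already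
  moves from \<open>(n, x, c)\<close> are those in the third row and those shortening the first row to a length \<open>m > y\<close>.\<close>
lemma P_shorten_second_row:
  assumes P: "P_position (n, x, c)" and "c < y" "y < x" "x \<le> n"
    and third: "\<And>b. b < c \<Longrightarrow> \<not> P_position (n, y, b)"
  shows "\<exists>m. y < m \<and> m < n \<and> P_position (m, y, c)"
proof -
  have "\<not> P_position (n, y, c)" "(n, y, c) \<noteq> (0, 0, 0)"
    using P_no_Second[OF P \<open>y < x\<close>] assms by auto
  then show ?thesis
  proof (cases rule: not_P_cases)
    case (First a)
    show ?thesis
    proof (cases "a \<le> y")
      case True
      then have "P_position (a, min a x, min a c)"
        using First \<open>y < x\<close> by (simp add: min_def split: if_splits)
      then show ?thesis
        using P_no_First[OF P] First by blast
    next
      case False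
      then have "y < a" "P_position (a, y, c)"
        using First \<open>c < y\<close> by (simp_all add: min_def split: if_splits)
      then show ?thesis
        using First by blast
    qed
  next
    case (Second a)
    then show ?thesis
      using P_no_Second[OF P, of a] \<open>y < x\<close> by simp
  next
    case (Third b)
    then show ?thesis
      using third by blast
  qed
qed

lemma D_S_positions_exclusive:
  assumes D: "P_position (n, a, a)" and S: "P_position (n, n, r)" and "a < n"
  shows False
\<comment> \<open>If \<open>a \<le> r\<close>, cutting the second row of \<open>(n, n, r)\<close> to
  \<open>a\<close> gives \<open>(n, a, a)\<close> directly.\<close>
proof (cases "a \<le> r")
  case True
  then show False
    using P_no_Second[OF S \<open>a < n\<close>] D by (simp add: min_def)
next
  case False
  \<comment> \<open>The bound \<open>r < y\<close> keeps a third row of length at most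
    \<open>r\<close> unchanged when the second is cut to \<open>y\<close>.\<close>
  define Y where "Y = {y. r < y \<and> y < n \<and> (\<forall>c<r. \<not> P_position (n, y, c))}"
  have "a \<in> Y"
    using False \<open>a < n\<close> P_no_Third[OF D] by (auto simp: Y_def)
  moreover have "finite Y"
    by (rule finite_subset[of _ "{..<n}"]) (auto simp: Y_def)
  ultimately have "Max Y \<in> Y" and above: "\<And>y. y \<in> Y \<Longrightarrow> y \<le> Max Y"
    by (auto intro: Max_in)
  define y where "y = Max Y"
  have y: "r < y" "y < n" and free: "\<And>c. c < r \<Longrightarrow> \<not> P_position (n, y, c)"
    using \<open>Max Y \<in> Y\<close> by (auto simp: y_def Y_def)
  have "\<exists>c<r. P_position (n, x, c)" if "y < x" "x < n" for x
  proof -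
    have "x \<notin> Y"
      using above[of x] that by (auto simp: y_def)
    then show ?thesis
      using that y by (auto simp: Y_def)
  qed
  then obtain c where c: "\<And>x. y < x \<Longrightarrow> x < n \<Longrightarrow> c x < r \<and> P_position (n, x, c x)"
    by metis
  \<comment> \<open>The value at \<open>x = n\<close> adds the position \<open>(n, n, r)\<close> to
    the family, giving \<open>n - y\<close> rows in all.\<close>
  define row where "row x = (if x = n then r else c x)" for x
  have row: "row x \<le> r" "P_position (n, x, row x)" if "y < x" "x \<le> n" for x
    using c[of x] that S by (auto simp: row_def)
  have row_neq: "row x \<noteq> row x'" if "y < x" "x < x'" "x' \<le> n" for x x'
  proof
    assume eq: "row x = row x'"
    have "P_position (n, x', row x)" "P_position (n, x, row x)" "row x \<le> x"
      using row[of x] row[of x'] that eq y by auto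
    then show False
      using P_no_Second[of n x' "row x" x] that by (simp add: min_def split: if_splits)
  qed
  have "\<exists>m. y < m \<and> m < n \<and> P_position (m, y, row x)" if "y < x" "x \<le> n" for x
    using row[OF that] that y free by (intro P_shorten_second_row[of n x]) auto
  then obtain m where m: "\<And>x. y < x \<Longrightarrow> x \<le> n \<Longrightarrow> y < m x \<and> m x < n \<and> P_position (m x, y, row x)"
    by metis
  \<comment> \<open>Equal values of \<open>m\<close> with different third rows would give two
    P-positions joined by a third-row move.\<close>
  have "inj_on m {y<..n}"
  proof (rule inj_onI)
    fix x x' assume "x \<in> {y<..n}" "x' \<in> {y<..n}" "m x = m x'"
    then have "\<not> row x < row x'" "\<not> row x' < row x"
      using m[of x] m[of x'] P_no_Third[of "m x" y] by auto
    then show "x = x'"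
      using row_neq[of x x'] row_neq[of x' x] \<open>x \<in> _\<close> \<open>x' \<in> _\<close>
      by (metis greaterThanAtMost_iff linorder_neqE_nat)
  qed
  moreover have "m ` {y<..n} \<subseteq> {y<..<n}"
    using m by auto
  ultimately have "card {y<..n} \<le> card {y<..<n}"
    by (meson card_inj_on_le finite_greaterThanLessThan)
  then show False
    using y by simp
qed

section \<open>Winning opening moves expressed through \<open>f\<close>\<close>

text \<open>A first-row move from a cube leaves a smaller cube.\<close>

lemma not_winning_First: "\<not> winning_move First (n, n, n) y"
proof
  assume "winning_move First (n, n, n) y"
  then have "move First (n, n, n) y" "P_position y"
    by (simp_all add: winning_move_def)
  then show False
    by cases (simp add: cube_not_P)
qed

text \<open>The bound \<open>a < n\<close> is implicit in \<open>f a a = n\<close>, since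
  \<open>a < f a a\<close>.\<close>

lemma winning_Second_iff: "winning_move Second (n, n, n) y \<longleftrightarrow> (\<exists>a. y = (n, a, a) \<and> f a a = n)"
proof -
  have "move Second (n, n, n) y \<longleftrightarrow> (\<exists>a<n. y = (n, a, a))"
  proof
    assume "move Second (n, n, n) y"
    then show "\<exists>a<n. y = (n, a, a)"
      by cases auto
  next
    assume "\<exists>a<n. y = (n, a, a)"
    then show "move Second (n, n, n) y"
      using move.intros(2)[of _ n n n] by auto
  qed
  then show ?thesis
    using P_iff_f[OF order_refl, of _ n] less_f[OF order_refl] unfolding winning_move_def
    by (auto simp: less_imp_le)
qed

lemma winning_Third_iff: "winning_move Third (n, n, n) y \<longleftrightarrow> (\<exists>r<n. y = (n, n, r) \<and> f n r = n)"
proof -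
  have "move Third (n, n, n) y \<longleftrightarrow> (\<exists>r<n. y = (n, n, r))"
    by (subst move.simps) auto
  then show ?thesis
    using P_iff_f[OF less_imp_le order_refl, of _ n] unfolding winning_move_def by auto
qed

text \<open>For \<open>a < b\<close>, a second-row move leads from \<open>(n, b, b)\<close> to
  \<open>(n, a, a)\<close>.\<close>

lemma f_diag_inj: "f a a = f b b \<Longrightarrow> a = b"
proof (induction a b rule: linorder_wlog)
  case (le a b)
  have "P_position (f a a, a, a)" "P_position (f a a, b, b)"
    using less_f[of a a] less_f[of b b] le by (auto simp: P_iff_f)
  then show ?case
    using P_no_Second[of "f a a" b b a] le by (cases "a = b") (auto simp: min_def)
qed auto

lemma f_loop_unique:
  assumes "f n r = n" "f n r' = n" "r \<le> n" "r' \<le> n"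
  shows "r = r'"
proof -
  have "P_position (n, n, r)" "P_position (n, n, r')"
    using assms by (auto simp: P_iff_f)
  then show ?thesis
    using P_no_Third by (metis linorder_neqE_nat)
qed

lemma D_S_disjoint:
  assumes "f a a = n" "r \<le> n" "f n r = n"
  shows False
proof (rule D_S_positions_exclusive)
  show "a < n"
    using less_f[of a a] assms(1) by simp
  then show "P_position (n, a, a)"
    using P_iff_f[of a a n] assms(1) by simp
  show "P_position (n, n, r)"
    using P_iff_f[of r n n] assms(2,3) by simp
qed

text \<open>A cube with \<open>n \<ge> 1\<close> is not a P-position, so it has a winning move,
  which lies in the second or third row.\<close>

lemma D_or_S:
  assumes "n \<ge> 1"
  shows "(\<exists>a. f a a = n) \<or> (\<exists>r<n. f n r = n)"
proof -
  obtain i y where "winning_move i (n, n, n) y"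
    using assms cube_not_P[of n] P_position_iff[of "(n, n, n)"] unfolding winning_move_def by force
  then show ?thesis
    using not_winning_First winning_Second_iff winning_Third_iff by (cases i) auto
qed

lemma D_eq: "D = A029900"
proof -
  have "1 \<le> f a a" for a
    using less_f[of a a] by simp
  then show ?thesis
    unfolding D_def A029900_def winning_Second_iff by blast
qed

lemma S_eq: "S = A029901"
  by (auto simp: S_def A029901_def winning_Third_iff)

section \<open>Recursive computation of \<open>f\<close>\<close>

text \<open>A minimal-excluded-value rule: \<open>E\<close> collects the first rows \<open>p\<close>
  for which a second- or third-row move from \<open>(p, q, r)\<close> reaches a P-position. The
  premise \<open>active\<close> rules out a value of \<open>f q r\<close> below
  \<open>q\<close>.\<close>

lemma f_eqI:
  assumes "r \<le> q" "q \<le> v" "r < v" and active: "r < q \<Longrightarrow> q \<le> f (q - 1) r"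
    and fresh: "v \<notin> E" and least: "\<And>p. q \<le> p \<Longrightarrow> r < p \<Longrightarrow> p < v \<Longrightarrow> p \<in> E"
    and E: "E = (\<lambda>b. f b b) ` {..<r} \<union> (\<lambda>b. f b r) ` {r..<q} \<union> f q ` {..<r}"
  shows "f q r = v"
proof -
  define w where "w = f q r"
  have w: "r < w" "P_position (w, min w q, r)"
    using f_eq_iff[OF \<open>r \<le> q\<close>] by (auto simp: w_def)
  have "q \<le> w"
  proof (rule ccontr)
    assume "\<not> q \<le> w"
    then have "r < q" "f (q - 1) r = w"
      using w f_eq_iff[of r "q - 1" w] by (auto simp: min_def split: if_splits)
    then show False
      using active \<open>\<not> q \<le> w\<close> by simp
  qed
  then have P: "P_position (w, q, r)"
    using w by (simp add: min_def split: if_splits)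
  have "w \<notin> E"
  proof
    assume "w \<in> E"
    then consider b where "b < r" "P_position (w, b, b)" | b where "r \<le> b" "b < q" "P_position (w, b, r)"
      | c where "c < r" "P_position (w, q, c)"
      unfolding E using P_iff_f \<open>q \<le> w\<close> \<open>r \<le> q\<close> by force
    then show False
    proof cases
      case 1
      then show False
        using P_no_Second[OF P, of b] \<open>r \<le> q\<close> by (simp add: min_def split: if_splits)
    next
      case 2
      then show False
        using P_no_Second[OF P, of b] by (simp add: min_def split: if_splits)
    next
      case 3
      then show False
        using P_no_Third[OF P] by blast
    qed
  qed
  then have "v \<le> w"
    using least[of w] \<open>q \<le> w\<close> w by force
  \<comment> \<open>If \<open>v < w\<close>, then \<open>(v, q, r)\<close> has a winning move: one
    in the first row is also available from \<open>(w, q, r)\<close>, and any other puts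
    \<open>v\<close> into \<open>E\<close>.\<close>
  moreover have "\<not> v < w"
  proof
    assume "v < w"
    have "\<not> P_position (v, q, r)" "(v, q, r) \<noteq> (0, 0, 0)"
      using \<open>r < v\<close> P_iff_f[of r q v] \<open>r \<le> q\<close> \<open>q \<le> v\<close> \<open>v < w\<close> by (auto simp: w_def)
    then show False
    proof (cases rule: not_P_cases)
      case (First a)
      then show False
        using P_no_First[OF P, of a] \<open>v < w\<close> by simp
    next
      case (Second a)
      show False
      proof (cases "a < r")
        case True
        then have "f a a = v"
          using Second P_iff_f[of a a v] \<open>r < v\<close> by (simp add: min_def)
        then show False
          using True fresh by (auto simp: E)
      next
        case False
        then have "f a r = v"
          using Second P_iff_f[of r a v] \<open>q \<le> v\<close> by (simp add: min_def split: if_splits)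
        then show False
          using False Second fresh by (auto simp: E)
      qed
    next
      case (Third b)
      then have "f q b = v"
        using P_iff_f[of b q v] \<open>q \<le> v\<close> \<open>r \<le> q\<close> by simp
      then show False
        using Third fresh by (auto simp: E)
    qed
  qed
  ultimately show ?thesis
    by (simp add: w_def)
qed

text \<open>A value below \<open>q\<close> witnesses a P-position \<open>(p, p, r)\<close>, which
  does not involve \<open>q\<close>.\<close>

lemma f_retired:
  assumes "r < q" "f (q - 1) r < q"
  shows "f q r = f (q - 1) r"
proof -
  have "min (f (q - 1) r) (q - 1) = f (q - 1) r" "min (f (q - 1) r) q = f (q - 1) r"
    using assms by auto
  then show ?thesis
    using assms f_eq_iff[of r "q - 1" "f (q - 1) r"] f_eq_iff[of r q "f (q - 1) r"] by auto
qed

function least_free :: "nat \<Rightarrow> nat list \<Rightarrow> nat" where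
  "least_free p xs = (if p \<in> set xs then least_free (Suc p) xs else p)"
  by auto
termination
\<comment> \<open>The measure counts the entries that are still at least \<open>p\<close>.\<close>
proof (relation "measure (\<lambda>(p, xs). card (set xs \<inter> {p..}))")
  fix p and xs :: "nat list"
  assume "p \<in> set xs"
  moreover have "set xs \<inter> {Suc p..} = set xs \<inter> {p..} - {p}"
    by (auto simp: Suc_le_eq)
  ultimately show "((Suc p, xs), p, xs) \<in> measure (\<lambda>(p, xs). card (set xs \<inter> {p..}))"
    using card_Diff1_less[of "set xs \<inter> {p..}" p] by simp
qed simp

declare least_free.simps [simp del]

lemma least_free:
  "p \<le> least_free p xs" "least_free p xs \<notin> set xs"
  "p \<le> k \<Longrightarrow> k < least_free p xs \<Longrightarrow> k \<in> set xs"
proof (induction p xs rule: least_free.induct)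
  case (1 p xs)
  {
    case 1
    then show ?case
      using "1.IH"(1) by (subst least_free.simps) auto
  next
    case 2
    then show ?case
      using "1.IH"(2) by (subst least_free.simps) auto
  next
    case 3
    then show ?case
      using "1.IH"(3) least_free.simps[of p xs] by (cases "k = p") (auto split: if_splits)
  }
qed

text \<open>Newest value first, so that passing to the next \<open>q\<close> is a single
  cons.\<close>

definition history :: "nat \<Rightarrow> nat \<Rightarrow> nat list" where
  "history q r = map (\<lambda>b. f b r) (rev [r..<q])"

lemma history_self [simp]: "history q q = []"
  by (simp add: history_def)

lemma history_Suc: "r \<le> q \<Longrightarrow> history (Suc q) r = f q r # history q r"
  by (simp add: history_def)

text \<open>\<open>used\<close> lists the values \<open>f b b\<close> and \<open>f q b\<close> for the rows \<open>b\<close> already treated; the last entry of the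
  history of row \<open>r\<close> is \<open>f r r\<close>.\<close>
fun column :: "nat \<Rightarrow> nat list \<Rightarrow> nat list list \<Rightarrow> nat list" where
  "column q used [] = []"
| "column q used ([] # hs) = [least_free (Suc q) used]"
| "column q used ((x # h) # hs) =
    (let v = (if x < q then x else least_free q (used @ x # h)) in v # column q (v # last (x # h) # used) hs)"

text \<open>Induction on the number \<open>q - r\<close> of rows left, with \<open>used\<close>
  generalized because each treated row enlarges it.\<close>

lemma column_correct:
  assumes "r \<le> q" "set used = (\<lambda>b. f b b) ` {..<r} \<union> f q ` {..<r}"
  shows "column q used (map (history q) [r..<Suc q]) = map (f q) [r..<Suc q]"
  using assms
proof (induction "q - r" arbitrary: r used)
  case 0
  then have "r = q"
    by simp
  \<comment> \<open>The search starts at \<open>Suc q\<close> because \<open>f q q\<close> must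
    exceed \<open>q\<close>.\<close>
  have "f q q = least_free (Suc q) used"
    using least_free[where p = "Suc q" and xs = used] "0.prems" \<open>r = q\<close>
    by (intro f_eqI[where E = "set used"]) auto
  then show ?case
    using \<open>r = q\<close> by simp
next
  case (Suc k)
  then have r: "r < q" "r \<le> q"
    by auto
  define x h where "x = f (q - 1) r" and "h = history (q - 1) r"
  have hist: "history q r = x # h"
    using history_Suc[of r "q - 1"] r by (simp add: x_def h_def)
  have "set (history q r) = (\<lambda>b. f b r) ` {r..<q}"
    by (simp add: history_def)
  then have E: "set (used @ x # h) = (\<lambda>b. f b b) ` {..<r} \<union> (\<lambda>b. f b r) ` {r..<q} \<union> f q ` {..<r}"
    using hist Suc.prems by auto
  have last: "last (x # h) = f r r"
    using r unfolding hist[symmetric] by (simp add: history_def last_map last_rev)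
  have v: "f q r = (if x < q then x else least_free q (used @ x # h))"
  proof (cases "x < q")
    case True
    then show ?thesis
      using f_retired[of r q] r by (simp add: x_def)
  next
    case False
    have "f q r = least_free q (used @ x # h)"
    proof (rule f_eqI[where E = "set (used @ x # h)"])
      show "r < least_free q (used @ x # h)"
        using least_free(1)[of q "used @ x # h"] r by simp
      show "least_free q (used @ x # h) \<notin> set (used @ x # h)"
        by (rule least_free(2))
      show "p \<in> set (used @ x # h)" if "q \<le> p" "p < least_free q (used @ x # h)" for p
        using that by (rule least_free(3))
    qed (use least_free(1)[of q "used @ x # h"] r False E x_def in auto)
    then show ?thesis
      using False by simp
  qed
  \<comment> \<open>Later rows must avoid both \<open>f q r\<close> (third-row move) and
    \<open>f r r\<close> (second-row move).\<close>
  have "column q (f q r # f r r # used) (map (history q) [Suc r..<Suc q]) = map (f q) [Suc r..<Suc q]"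
    using Suc.hyps Suc.prems r by (intro Suc.hyps(1)) (auto simp: lessThan_Suc)
  moreover have "[r..<Suc q] = r # [Suc r..<Suc q]"
    using r by (simp add: upt_conv_Cons del: upt_Suc)
  ultimately show ?case
    using last by (simp add: hist v[symmetric] Let_def del: upt_Suc)
qed

text \<open>The appended \<open>[]\<close> is the still empty history of row
  \<open>q\<close>.\<close>

fun histories :: "nat \<Rightarrow> nat list list" where
  "histories 0 = []"
| "histories (Suc q) = (let hs = histories q @ [[]] in map2 (#) (column q [] hs) hs)"

lemma histories_correct: "histories q @ [[]] = map (history q) [0..<Suc q]"
proof (induction q)
  case (Suc q)
  have "map2 (#) (map (f q) xs) (map (history q) xs) = map (history (Suc q)) xs" if "set xs \<subseteq> {..q}" for xs
    using that by (induction xs) (auto simp: history_Suc)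
  then have "map2 (#) (map (f q) [0..<Suc q]) (map (history q) [0..<Suc q]) = map (history (Suc q)) [0..<Suc q]"
    by (simp add: subset_iff del: upt_Suc)
  then have "histories (Suc q) = map (history (Suc q)) [0..<Suc q]"
    using Suc column_correct[of 0 q "[]"] by (simp add: Let_def del: upt_Suc)
  then show ?case
    by (simp add: upt_Suc[of 0 "Suc q"] del: upt_Suc)
qed simp

section \<open>First terms of the two sequences\<close>

text \<open>Values at most \<open>N\<close> persist up to column \<open>N\<close>, so this one
  column reveals all of \<open>S\<close> up to \<open>N\<close>.\<close>

lemma S_atMost: "S \<inter> {..N} = {v \<in> set (column N [] (histories N @ [[]])). v \<le> N}"
proof -
  \<comment> \<open>Both sides say that \<open>r < v\<close> and \<open>(v, v, r)\<close> is a
    P-position.\<close>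
  have *: "f v r = v \<longleftrightarrow> f N r = v" if "r \<le> N" "v \<le> N" "r \<le> v" for v r
    using f_eq_iff[of r v v] f_eq_iff[of r N v] that by (simp add: min_def)
  have set_column: "set (column N [] (histories N @ [[]])) = f N ` {..N}"
    unfolding histories_correct using column_correct[of 0 N "[]"] by (auto simp del: upt_Suc)
  show ?thesis
  proof -
    have "v \<in> S \<longleftrightarrow> (\<exists>r\<le>N. f N r = v)" if "v \<le> N" for v
    proof
      assume "v \<in> S"
      then obtain r where "r < v" "f v r = v"
        by (auto simp: S_def)
      then show "\<exists>r\<le>N. f N r = v"
        using *[of r v] that by (intro exI[of _ r]) simp
    next
      assume "\<exists>r\<le>N. f N r = v"
      then obtain r where "r \<le> N" "f N r = v"
        by blast
      then have "r < v"
        using less_f by blast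
      then show "v \<in> S"
        using *[of r v] \<open>r \<le> N\<close> \<open>f N r = v\<close> that by (auto simp: S_def)
    qed
    then show ?thesis
      using set_column by auto
  qed
qed

lemma column_38:
  "filter (\<lambda>v. v \<le> 38) (column 38 [] (histories 38 @ [[]])) =
     [2, 5, 7, 9, 12, 14, 17, 19, 22, 23, 26, 29, 31, 33, 36, 38]"
  by code_simp

lemma S_atMost_38: "{n \<in> S. n \<le> 38} = {2, 5, 7, 9, 12, 14, 17, 19, 22, 23, 26, 29, 31, 33, 36, 38}"
proof -
  have "{n \<in> S. n \<le> 38} = S \<inter> {..38}"
    by auto
  also have "\<dots> = set (filter (\<lambda>v. v \<le> 38) (column 38 [] (histories 38 @ [[]])))"
    unfolding S_atMost set_filter ..
  also have "\<dots> = {2, 5, 7, 9, 12, 14, 17, 19, 22, 23, 26, 29, 31, 33, 36, 38}"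
    unfolding column_38 by simp
  finally show ?thesis .
qed

text \<open>\<open>D\<close> and \<open>S\<close> partition the positive integers: they cover by
  \<open>D_or_S\<close> and are disjoint by the pigeonhole argument. The terms of \<open>D\<close>
  thus follow from those of \<open>S\<close>.\<close>

lemma D_iff_not_S: "n \<in> D \<longleftrightarrow> n \<ge> 1 \<and> n \<notin> S"
proof
  assume "n \<in> D"
  then obtain a where a: "f a a = n"
    by (auto simp: D_def)
  then have "n \<ge> 1"
    using less_f[of a a] by simp
  moreover have "n \<notin> S"
    using D_S_disjoint[OF a less_imp_le] unfolding S_def by blast
  ultimately show "n \<ge> 1 \<and> n \<notin> S"
    by simp
next
  assume "n \<ge> 1 \<and> n \<notin> S"
  then show "n \<in> D"
    using D_or_S[of n] by (auto simp: D_def S_def)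
qed

lemma D_atMost_27: "{n \<in> D. n \<le> 27} = {1, 3, 4, 6, 8, 10, 11, 13, 15, 16, 18, 20, 21, 24, 25, 27}"
proof -
  have "{n \<in> D. n \<le> 27} = {1..27} - {n \<in> S. n \<le> 38}"
    unfolding D_iff_not_S by auto
  also have "\<dots> = {1, 3, 4, 6, 8, 10, 11, 13, 15, 16, 18, 20, 21, 24, 25, 27}"
    unfolding S_atMost_38 by code_simp
  finally show ?thesis .
qed

theorem corollary4p5:
  shows "(\<forall>n\<ge>1.
            (\<exists>!m. winning_move (fst m) (n, n, n) (snd m)) \<and>
            \<not> (\<exists>y. winning_move First (n, n, n) y) \<and>
            ((\<exists>y. winning_move Second (n, n, n) y) \<longleftrightarrow> n \<in> D) \<and>
            (n \<in> D \<longrightarrow>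
              (\<exists>a<n. (\<forall>a'. n = f a' a' \<longleftrightarrow> a' = a) \<and>
                     (\<forall>y. winning_move Second (n, n, n) y \<longleftrightarrow> y = (n, a, a)))) \<and>
            ((\<exists>y. winning_move Third (n, n, n) y) \<longleftrightarrow> n \<in> S) \<and>
            (n \<in> S \<longrightarrow>
              (\<exists>r<n. (\<forall>r'\<le>n. f n r' = n \<longleftrightarrow> r' = r) \<and>
                     (\<forall>y. winning_move Third (n, n, n) y \<longleftrightarrow> y = (n, n, r))))) \<and>
         D = A029900 \<and> S = A029901 \<and>
         sorted_list_of_set {n \<in> A029900. n \<le> 27} =
           [1, 3, 4, 6, 8, 10, 11, 13, 15, 16, 18, 20, 21, 24, 25, 27] \<and>
         sorted_list_of_set {n \<in> A029901. n \<le> 38} =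
           [2, 5, 7, 9, 12, 14, 17, 19, 22, 23, 26, 29, 31, 33, 36, 38]"
proof (intro conjI allI impI D_eq S_eq)
  fix n :: nat
  assume "n \<ge> 1"
  show "\<not> (\<exists>y. winning_move First (n, n, n) y)"
    using not_winning_First by blast
  show second: "(\<exists>y. winning_move Second (n, n, n) y) \<longleftrightarrow> n \<in> D"
    by (auto simp: winning_Second_iff D_def)
  show third: "(\<exists>y. winning_move Third (n, n, n) y) \<longleftrightarrow> n \<in> S"
    using \<open>n \<ge> 1\<close> by (auto simp: winning_Third_iff S_def)
  show D_move: "\<exists>a<n. (\<forall>a'. n = f a' a' \<longleftrightarrow> a' = a) \<and>
      (\<forall>y. winning_move Second (n, n, n) y \<longleftrightarrow> y = (n, a, a))" if "n \<in> D"
  proof -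
    obtain a where a: "f a a = n"
      using \<open>n \<in> D\<close> unfolding D_def by blast
    have *: "f a' a' = n \<longleftrightarrow> a' = a" for a'
      using f_diag_inj[of a' a] a by auto
    have "winning_move Second (n, n, n) y \<longleftrightarrow> y = (n, a, a)" for y
      by (simp add: winning_Second_iff *)
    moreover have "n = f a' a' \<longleftrightarrow> a' = a" for a'
      using *[of a'] by (simp only: eq_commute)
    moreover have "a < n"
      using less_f[of a a] a by simp
    ultimately show ?thesis
      by blast
  qed
  show S_move: "\<exists>r<n. (\<forall>r'\<le>n. f n r' = n \<longleftrightarrow> r' = r) \<and>
      (\<forall>y. winning_move Third (n, n, n) y \<longleftrightarrow> y = (n, n, r))" if "n \<in> S"
  proof -
    obtain r where r: "r < n" "f n r = n"
      using \<open>n \<in> S\<close> by (auto simp: S_def)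
    have *: "f n r' = n \<longleftrightarrow> r' = r" if "r' \<le> n" for r'
      using f_loop_unique[of n r' r] r that by auto
    have "winning_move Third (n, n, n) y \<longleftrightarrow> y = (n, n, r)" for y
      unfolding winning_Third_iff using * r less_imp_le by metis
    then show ?thesis
      using * r by blast
  qed
  \<comment> \<open>\<open>m\<close> pairs the row of a move with the resulting position; the
    partition into \<open>D\<close> and \<open>S\<close> selects the row.\<close>
  show "\<exists>!m. winning_move (fst m) (n, n, n) (snd m)"
  proof (cases "n \<in> D")
    case True
    then obtain a where "\<And>y. winning_move Second (n, n, n) y \<longleftrightarrow> y = (n, a, a)"
      using D_move by blast
    moreover have "\<not> winning_move Third (n, n, n) y" for y
      using third True D_iff_not_S by blast
    ultimately have "winning_move i (n, n, n) y \<longleftrightarrow> (i, y) = (Second, (n, a, a))" for i y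
      using not_winning_First by (cases i) auto
    then show ?thesis
      by (intro ex1I[of _ "(Second, (n, a, a))"]) (auto simp: prod_eq_iff)
  next
    case False
    then have "n \<in> S"
      using D_iff_not_S \<open>n \<ge> 1\<close> by blast
    then obtain r where "\<And>y. winning_move Third (n, n, n) y \<longleftrightarrow> y = (n, n, r)"
      using S_move by blast
    moreover have "\<not> winning_move Second (n, n, n) y" for y
      using second False by blast
    ultimately have "winning_move i (n, n, n) y \<longleftrightarrow> (i, y) = (Third, (n, n, r))" for i y
      using not_winning_First by (cases i) auto
    then show ?thesis
      by (intro ex1I[of _ "(Third, (n, n, r))"]) (auto simp: prod_eq_iff)
  qed
next
  show "sorted_list_of_set {n \<in> A029900. n \<le> 27} =
      [1, 3, 4, 6, 8, 10, 11, 13, 15, 16, 18, 20, 21, 24, 25, 27]"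
    unfolding D_eq[symmetric] D_atMost_27 by simp
  show "sorted_list_of_set {n \<in> A029901. n \<le> 38} =
      [2, 5, 7, 9, 12, 14, 17, 19, 22, 23, 26, 29, 31, 33, 36, 38]"
    unfolding S_eq[symmetric] S_atMost_38 by simp
qed

end
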